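(* Let $L$ be a Hausdorff space of countable character such that the space $L^\omega$ (with the product topology) is c.c.c. Let $\kappa$ be a cardinal and let $X$ be a dense subspace of $L^\kappa$ (with the product topology) which is submaximal. Then $X$ has disjoint tightness.
   Context: A space has countable character if every point has a countable local base. A space is c.c.c. if every family of pairwise disjoint nonempty open sets is countable. A space is submaximal if all its dense subsets are open. $A'$ denotes the set of accumulation points of $A$ ($x\in A'$ iff every neighborhood of $x$ contains a point of $A\setminus\{x\}$). A space $X$ has disjoint tightness if whenever $A\subseteq X$ and $x\in A'$ there are $A_1,A_2\subseteq A$ such that $A_1\cap A_2=\emptyset$ and $x\in A_1'\cap A_2'$. *)

theory Defs
  imports "HOL-Analysis.Analysis"
begin

definition ccc_space :: "'a topology \<Rightarrow> bool" where
  "ccc_space X \<longleftrightarrow>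
     (\<forall>\<U>. (\<forall>U\<in>\<U>. openin X U \<and> U \<noteq> {}) \<and> pairwise disjnt \<U> \<longrightarrow> countable \<U>)"

definition dense_subset_of :: "'a topology \<Rightarrow> 'a set \<Rightarrow> bool" where
  "dense_subset_of X D \<longleftrightarrow> D \<subseteq> topspace X \<and> X closure_of D = topspace X"

definition submaximal_space :: "'a topology \<Rightarrow> bool" where
  "submaximal_space X \<longleftrightarrow> (\<forall>D. dense_subset_of X D \<longrightarrow> openin X D)"

definition disjoint_tightness :: "'a topology \<Rightarrow> bool" where
  "disjoint_tightness X \<longleftrightarrow>
     (\<forall>A x. A \<subseteq> topspace X \<and> x \<in> X derived_set_of A \<longrightarrow>
        (\<exists>A1 A2. A1 \<subseteq> A \<and> A2 \<subseteq> A \<and> A1 \<inter> A2 = {} \<and>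
           x \<in> X derived_set_of A1 \<inter> X derived_set_of A2))"

(* The power of L indexed by a set I; its points are the functions on I, extended by
   undefined outside I. The set I stands for a cardinal: up to homeomorphism the power
   depends only on the cardinality of I. *)
abbreviation power_topology :: "'a topology \<Rightarrow> 'i set \<Rightarrow> ('i \<Rightarrow> 'a) topology" where
  "power_topology L I \<equiv> product_topology (\<lambda>_. L) I"

end

theory Submission
  imports Defs
begin

text \<open>
  Removing \<open>x\<close> from \<open>A\<close>, submaximality lets us replace \<open>A\<close> by its interior in \<open>X\<close>, that is, by the
  trace on \<open>X\<close> of an open set \<open>W\<close> of \<open>L\<^sup>\<kappa>\<close> with \<open>x\<close> in its closure but not in \<open>W\<close>. Since the
  countable powers of \<open>L\<close> are c.c.c., a closing-off argument yields a countable set \<open>S\<close> of coordinates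
  and an open \<open>V\<close> in \<open>L\<^sup>S\<close> whose preimage is dense in \<open>W\<close>. The space \<open>L\<^sup>S\<close> is Hausdorff and first
  countable, so \<open>V\<close> contains a sequence of disjoint open sets approaching the projection of \<open>x\<close>; the
  even and the odd members pull back to the two required sets, because the projection is open and
  \<open>X\<close> is dense.
\<close>

section \<open>Submaximality: replacing a set by its interior\<close>

text \<open>What remains of \<open>A - {x}\<close> outside its interior has empty interior, so its
  complement is dense and therefore open. The remainder \<open>B\<close> is thus closed and misses
  \<open>x\<close>, so \<open>x\<close> can only be approached through the interior.\<close>

lemma submaximal_derived_set_imp_closure_of_interior:
  assumes "submaximal_space X" and "A \<subseteq> topspace X" and "x \<in> X derived_set_of A"
  shows "x \<in> X closure_of (X interior_of (A - {x}))"
proof -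
  define I where "I = X interior_of (A - {x})"
  define B where "B = A - {x} - I"
  have "X interior_of B \<subseteq> I"
    unfolding I_def B_def by (intro interior_of_mono) auto
  moreover have "X interior_of B \<inter> I = {}"
    using interior_of_subset[of X B] by (auto simp: B_def)
  ultimately have "X interior_of B = {}" by blast
  then have "dense_subset_of X (topspace X - B)"
    by (simp add: dense_subset_of_def closure_of_complement)
  then have "openin X (topspace X - B)"
    using assms(1) by (simp add: submaximal_space_def)
  moreover have "B \<subseteq> topspace X" using assms(2) by (auto simp: B_def)
  ultimately have "X closure_of B = B"
    by (simp add: closedin_def closure_of_eq)
  moreover have "A - {x} = I \<union> B"
    using interior_of_subset[of X "A - {x}"] by (auto simp: B_def I_def)
  moreover have "x \<in> X closure_of (A - {x})"
    using assms(3) by (auto simp: in_derived_set_of in_closure_of)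
  ultimately have "x \<in> X closure_of I \<union> B" by simp
  then show ?thesis by (auto simp: B_def I_def)
qed

section \<open>The countable chain condition\<close>

text \<open>A maximal disjoint family of nonempty open sets refining \<U> is countable by c.c.c.;
  \<V> picks one member of \<U> above each of its sets. Maximality leaves no room for an open set
  that meets \<Union>\<U> but not \<Union>\<V>.\<close>

lemma ccc_space_countable_subfamily:
  assumes "ccc_space X" and op: "\<And>U. U \<in> \<U> \<Longrightarrow> openin X U"
  obtains \<V> where "countable \<V>" "\<V> \<subseteq> \<U>" "\<Union>\<U> \<subseteq> X closure_of \<Union>\<V>"
proof -
  define \<A> where "\<A> = {\<F>. (\<forall>F\<in>\<F>. openin X F \<and> F \<noteq> {} \<and> (\<exists>U\<in>\<U>. F \<subseteq> U)) \<and> pairwise disjnt \<F>}"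
  have "\<exists>\<M>\<in>\<A>. \<forall>\<F>\<in>\<A>. \<M> \<subseteq> \<F> \<longrightarrow> \<F> = \<M>"
  proof (rule subset_Zorn')
    fix \<C> assume "subset.chain \<A> \<C>"
    then show "\<Union>\<C> \<in> \<A>"
      by (auto simp: \<A>_def subset_chain_def chain_subset_def intro!: pairwise_chain_Union)
  qed
  then obtain \<M> where \<M>: "\<M> \<in> \<A>" and max: "\<And>\<F>. \<F> \<in> \<A> \<Longrightarrow> \<M> \<subseteq> \<F> \<Longrightarrow> \<F> = \<M>"
    by auto
  have "countable \<M>"
    using \<M> assms(1) by (auto simp: \<A>_def ccc_space_def)
  obtain u where u: "\<And>F. F \<in> \<M> \<Longrightarrow> u F \<in> \<U> \<and> F \<subseteq> u F"
    using \<M> unfolding \<A>_def by auto metis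
  show thesis
  proof
    show "countable (u ` \<M>)" using \<open>countable \<M>\<close> by simp
    show "u ` \<M> \<subseteq> \<U>" using u by auto
    show "\<Union>\<U> \<subseteq> X closure_of \<Union>(u ` \<M>)"
    proof clarify
      fix x U assume x: "x \<in> U" "U \<in> \<U>"
      have "\<exists>y. y \<in> \<Union>(u ` \<M>) \<and> y \<in> T" if T: "x \<in> T" "openin X T" for T
      proof (rule ccontr)
        assume no: "\<not> ?thesis"
        then have disj: "F \<inter> (T \<inter> U) = {}" if "F \<in> \<M>" for F
          using u[OF that] that by blast
        have "insert (T \<inter> U) \<M> \<in> \<A>"
          using \<M> disj x T op[OF x(2)]
          by (auto simp: \<A>_def pairwise_insert disjnt_def Int_commute)
        \<comment> \<open>Being already in \<M>, the set \<open>T \<inter> U\<close> falls under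
          \<open>disj\<close> and is disjoint from itself, although it contains
          \<open>x\<close>.\<close>
        then have "T \<inter> U \<in> \<M>" using max by blast
        with disj x T show False by blast
      qed
      moreover have "x \<in> topspace X" using op x openin_subset by blast
      ultimately show "x \<in> X closure_of \<Union>(u ` \<M>)" by (simp add: in_closure_of)
    qed
  qed
qed

lemma ccc_space_continuous_map_image:
  assumes "ccc_space X" "continuous_map X Y f" "f ` topspace X = topspace Y"
  shows "ccc_space Y"
  unfolding ccc_space_def
proof (intro allI impI)
  fix \<U> assume \<U>: "(\<forall>U\<in>\<U>. openin Y U \<and> U \<noteq> {}) \<and> pairwise disjnt \<U>"
  define p where "p U = {x \<in> topspace X. f x \<in> U}" for U
  \<comment> \<open>By surjectivity \<open>f\<close> recovers \<open>U\<close> from its preimage.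
    This makes preimages of nonempty sets nonempty and makes \<open>p\<close> injective, so
    countability passes back to \<U>.\<close>
  have fp: "f ` p U = U" if "U \<in> \<U>" for U
  proof -
    have "U \<subseteq> f ` topspace X" using \<U> that assms(3) openin_subset by metis
    then show ?thesis by (auto simp: p_def)
  qed
  then have inj: "inj_on p \<U>" by (rule inj_on_inverseI)
  have "countable (p ` \<U>)"
  proof -
    have "openin X W \<and> W \<noteq> {}" if "W \<in> p ` \<U>" for W
    proof -
      obtain U where U: "U \<in> \<U>" "W = p U" using \<open>W \<in> p ` \<U>\<close> by blast
      then have "W \<noteq> {}" using fp[OF U(1)] \<U> by auto
      moreover have "openin X W"
        unfolding U(2) p_def using \<U> U(1)
        by (intro openin_continuous_map_preimage[OF assms(2)]) auto
      ultimately show ?thesis by simp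
    qed
    moreover have "pairwise disjnt (p ` \<U>)"
      using \<U> by (auto simp: pairwise_image disjnt_iff p_def intro: pairwise_mono)
    ultimately show ?thesis
      using assms(1) by (simp add: ccc_space_def)
  qed
  then show "countable \<U>" using inj countable_image_inj_on by blast
qed

text \<open>Reindexing along \<open>to_nat_on S\<close> presents the power over \<open>S\<close> as
  a continuous image of the power over the naturals, for finite and infinite \<open>S\<close>
  alike.\<close>

lemma ccc_space_countable_power:
  assumes "ccc_space (power_topology L (UNIV :: nat set))" "countable S" "topspace L \<noteq> {}"
  shows "ccc_space (power_topology L S)"
proof -
  obtain a where a: "a \<in> topspace L" using assms(3) by blast
  define r where "r f = (\<lambda>i\<in>S. f (to_nat_on S i))" for f :: "nat \<Rightarrow> 'a"
  have "continuous_map (power_topology L UNIV) (power_topology L S) r"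
    by (auto simp: continuous_map_componentwise r_def intro!: continuous_map_product_projection)
  moreover have "g \<in> r ` topspace (power_topology L UNIV)" if "g \<in> topspace (power_topology L S)" for g
  proof
    \<comment> \<open>The default \<open>a\<close> fills the positions not hit by
      \<open>to_nat_on S\<close>; such positions exist only when \<open>S\<close> is finite.\<close>
    let ?f = "\<lambda>n. if n \<in> to_nat_on S ` S then g (from_nat_into S n) else a"
    show "?f \<in> topspace (power_topology L UNIV)"
      using that a assms(2) by (auto simp: PiE_iff)
    show "g = r ?f"
      using that assms(2) by (intro extensionalityI[of _ S]) (auto simp: r_def PiE_iff)
  qed
  moreover have "r ` topspace (power_topology L UNIV) \<subseteq> topspace (power_topology L S)"
    by (auto simp: r_def)
  ultimately show ?thesis
    by (intro ccc_space_continuous_map_image[OF assms(1), of _ r]) auto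
qed

section \<open>Local bases and restriction maps in products\<close>

lemma first_countable_countable_product:
  assumes "countable I" and fc: "\<And>i. i \<in> I \<Longrightarrow> first_countable (X i)"
  shows "first_countable (product_topology X I)"
  unfolding first_countable_def
proof
  fix x assume x: "x \<in> topspace (product_topology X I)"
  let ?P = "product_topology X I"
  have "\<exists>\<B>. countable \<B> \<and> (\<forall>V\<in>\<B>. openin (X i) V) \<and>
      (\<forall>U. openin (X i) U \<and> x i \<in> U \<longrightarrow> (\<exists>V\<in>\<B>. x i \<in> V \<and> V \<subseteq> U))" if "i \<in> I" for i
    using fc[OF that] x that unfolding first_countable_def topspace_product_topology
    by (auto simp: PiE_iff)
  then obtain B where cB: "\<And>i. i \<in> I \<Longrightarrow> countable (B i)"
    and oB: "\<And>i V. i \<in> I \<Longrightarrow> V \<in> B i \<Longrightarrow> openin (X i) V"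
    and bB: "\<And>i U. i \<in> I \<Longrightarrow> openin (X i) U \<Longrightarrow> x i \<in> U \<Longrightarrow> \<exists>V\<in>B i. x i \<in> V \<and> V \<subseteq> U"
    by metis
  define c where "c i V = {y \<in> topspace ?P. y i \<in> V}" for i V
  \<comment> \<open>There are countably many cylinders over the local bases, hence countably many
    finite intersections of them. Intersecting with the whole space in \<B> also handles the empty
    family, which arises from a box with no constrained coordinate.\<close>
  define \<S> where "\<S> = (\<Union>i\<in>I. c i ` B i)"
  define \<B> where "\<B> = (\<lambda>\<T>. topspace ?P \<inter> \<Inter>\<T>) ` {\<T>. \<T> \<subseteq> \<S> \<and> finite \<T>}"
  have oc: "openin ?P (c i V)" if "i \<in> I" "openin (X i) V" for i V
    unfolding c_def using that
    by (intro openin_continuous_map_preimage[OF continuous_map_product_projection])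
  show "\<exists>\<B>. countable \<B> \<and> (\<forall>V\<in>\<B>. openin ?P V) \<and>
      (\<forall>U. openin ?P U \<and> x \<in> U \<longrightarrow> (\<exists>V\<in>\<B>. x \<in> V \<and> V \<subseteq> U))"
  proof (intro exI conjI ballI allI impI)
    have "countable \<S>" unfolding \<S>_def using assms(1) cB by blast
    then have "countable {\<T>. \<T> \<subseteq> \<S> \<and> finite \<T>}"
      using countable_Collect_finite_subset by (simp add: conj_commute)
    then show "countable \<B>" unfolding \<B>_def by simp
  next
    fix V assume "V \<in> \<B>"
    then obtain \<T> where V: "V = topspace ?P \<inter> \<Inter>\<T>" "finite \<T>" "\<T> \<subseteq> \<S>"
      by (auto simp: \<B>_def)
    have "openin ?P K" if "K \<in> \<T>" for K
      using that V(3) oc oB unfolding \<S>_def by blast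
    then show "openin ?P V"
      unfolding V(1) using V(2) by (intro openin_Int_Inter openin_topspace)
  next
    fix U assume U: "openin ?P U \<and> x \<in> U"
    then obtain W where W: "finite {i \<in> I. W i \<noteq> topspace (X i)}"
        "\<And>i. i \<in> I \<Longrightarrow> openin (X i) (W i)" "x \<in> PiE I W" "PiE I W \<subseteq> U"
      unfolding openin_product_topology_alt by metis
    have "\<exists>V. V \<in> B i \<and> x i \<in> V \<and> V \<subseteq> W i" if "i \<in> I" for i
      using bB[OF that W(2)[OF that]] PiE_mem[OF W(3) that] by blast
    then obtain b where b: "\<And>i. i \<in> I \<Longrightarrow> b i \<in> B i \<and> x i \<in> b i \<and> b i \<subseteq> W i"
      by metis
    let ?F = "{i \<in> I. W i \<noteq> topspace (X i)}"
    let ?V = "topspace ?P \<inter> \<Inter>((\<lambda>i. c i (b i)) ` ?F)"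
    show "\<exists>V\<in>\<B>. x \<in> V \<and> V \<subseteq> U"
    proof (intro bexI conjI)
      show "?V \<in> \<B>" unfolding \<B>_def
        by (rule imageI) (use W(1) b in \<open>auto simp: \<S>_def intro!: imageI\<close>)
      show "x \<in> ?V" using x b by (auto simp: c_def)
      have "?V \<subseteq> PiE I W"
      proof
        fix y assume y: "y \<in> ?V"
        have "y i \<in> W i" if "i \<in> I" for i
          using y b[OF that] that by (cases "W i = topspace (X i)") (auto simp: c_def)
        then show "y \<in> PiE I W" using y by (auto simp: PiE_iff)
      qed
      then show "?V \<subseteq> U" using W(4) by (rule order_trans)
    qed
  qed
qed

lemma open_map_restrict_product_topology:
  assumes "J \<subseteq> I"
  shows "open_map (product_topology X I) (product_topology X J) (\<lambda>f. restrict f J)"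
  unfolding open_map_def
proof (intro allI impI)
  fix U assume U: "openin (product_topology X I) U"
  show "openin (product_topology X J) ((\<lambda>f. restrict f J) ` U)"
    unfolding openin_product_topology_alt
  proof clarify
    fix f assume "f \<in> U"
    then obtain V where V: "finite {i \<in> I. V i \<noteq> topspace (X i)}"
        "\<forall>i\<in>I. openin (X i) (V i)" "f \<in> PiE I V" "PiE I V \<subseteq> U"
      using U unfolding openin_product_topology_alt by meson
    show "\<exists>V. finite {i \<in> J. V i \<noteq> topspace (X i)} \<and> (\<forall>i\<in>J. openin (X i) (V i)) \<and>
        restrict f J \<in> PiE J V \<and> PiE J V \<subseteq> (\<lambda>f. restrict f J) ` U"
    proof (intro exI conjI subsetI)
      show "finite {i \<in> J. V i \<noteq> topspace (X i)}"
        by (rule finite_subset[OF _ V(1)]) (use assms in auto)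
      show "\<forall>i\<in>J. openin (X i) (V i)" "restrict f J \<in> PiE J V"
        using V assms by auto
      fix g assume g: "g \<in> PiE J V"
      \<comment> \<open>Coordinates outside \<open>J\<close> are borrowed from \<open>f\<close>,
        which lies in the box already; so the lift of \<open>g\<close> stays in the box and hence in
        \<open>U\<close>.\<close>
      let ?h = "\<lambda>i. if i \<in> J then g i else f i"
      have "?h \<in> PiE I V" using g V(3) assms by (auto simp: PiE_iff extensional_def)
      then have "?h \<in> U" using V(4) by (rule subsetD[rotated])
      then have "restrict ?h J \<in> (\<lambda>f. restrict f J) ` U" by (rule imageI)
      moreover have "restrict ?h J = g"
        using g by (intro extensionalityI[of _ J]) (auto simp: PiE_iff)
      ultimately show "g \<in> (\<lambda>f. restrict f J) ` U" by (simp only:)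
    qed
  qed
qed

text \<open>The image of a neighbourhood of \<open>x\<close> is a neighbourhood of
  \<open>f x\<close> and so meets \<open>S\<close>. Continuity moves closures forward; openness, as
  here, pulls them back.\<close>

lemma open_map_preimage_closure_of:
  assumes "open_map X Y f" "x \<in> topspace X" "f x \<in> Y closure_of S"
  shows "x \<in> X closure_of {z \<in> topspace X. f z \<in> S}"
  unfolding in_closure_of
proof (intro conjI allI impI)
  fix T assume T: "x \<in> T \<and> openin X T"
  then have "openin Y (f ` T)" "f x \<in> f ` T" using assms(1) by (auto simp: open_map_def)
  then obtain y where "y \<in> S" "y \<in> f ` T" using assms(3) unfolding in_closure_of by blast
  then show "\<exists>y. y \<in> {z \<in> topspace X. f z \<in> S} \<and> y \<in> T"
    using T openin_subset by blast
qed (fact assms(2))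

section \<open>Splitting an open set near a point of its boundary\<close>

lemma first_countable_sequence:
  assumes "first_countable X" "x \<in> topspace X"
  obtains B :: "nat \<Rightarrow> 'a set" where "\<And>n. openin X (B n)" "\<And>n. x \<in> B n"
    "\<And>U. openin X U \<Longrightarrow> x \<in> U \<Longrightarrow> \<exists>n. B n \<subseteq> U"
proof -
  obtain \<B> where \<B>: "countable \<B>" "\<And>V. V \<in> \<B> \<Longrightarrow> openin X V"
      "\<And>U. openin X U \<Longrightarrow> x \<in> U \<Longrightarrow> \<exists>V\<in>\<B>. x \<in> V \<and> V \<subseteq> U"
    using assms unfolding first_countable_def by metis
  \<comment> \<open>The members of \<B> need not all contain \<open>x\<close>; those that do still
    form a local base.\<close>
  define \<C> where "\<C> = {V \<in> \<B>. x \<in> V}"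
  have ne: "\<C> \<noteq> {}" using \<B>(3)[of "topspace X"] assms(2) by (auto simp: \<C>_def)
  have cnt: "countable \<C>" using \<B>(1) by (auto simp: \<C>_def)
  have "from_nat_into \<C> n \<in> \<C>" for n using ne by (rule from_nat_into)
  moreover have "\<exists>n. from_nat_into \<C> n \<subseteq> U" if "openin X U" "x \<in> U" for U
    using \<B>(3)[OF that] from_nat_into_surj[OF cnt] by (fastforce simp: \<C>_def)
  ultimately show thesis
    using that[of "from_nat_into \<C>"] \<B>(2) by (simp add: \<C>_def)
qed

text \<open>Shrinking neighbourhoods of \<open>x\<close> are built, each stage leaving behind a
  nonempty open piece of \<open>V\<close> outside the next neighbourhood. The pieces are disjoint
  and converge to \<open>x\<close>, so any infinitely many of them accumulate there; even and odd
  stages give \<open>V1\<close> and \<open>V2\<close>.\<close>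

lemma Hausdorff_first_countable_split_open:
  assumes "Hausdorff_space X" "first_countable X" "openin X V" "x \<in> X closure_of V" "x \<notin> V"
  obtains V1 V2 where "openin X V1" "openin X V2" "V1 \<subseteq> V" "V2 \<subseteq> V" "V1 \<inter> V2 = {}" "x \<in> X closure_of V1" "x \<in> X closure_of V2"
proof -
  have xX: "x \<in> topspace X" using assms(4) by (simp add: in_closure_of)
  obtain B where B: "\<And>n. openin X (B n)" "\<And>n. x \<in> B n"
    and base: "\<And>U. openin X U \<Longrightarrow> x \<in> U \<Longrightarrow> \<exists>n::nat. B n \<subseteq> U"
    using first_countable_sequence[OF assms(2) xX] by metis
  have step: "\<exists>C' Q. openin X C' \<and> x \<in> C' \<and> C' \<subseteq> C \<and> openin X Q \<and> Q \<subseteq> C \<inter> V \<and> Q \<noteq> {} \<and> Q \<inter> C' = {}"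
    if C: "openin X C" "x \<in> C" for C
  proof -
    \<comment> \<open>Since \<open>x\<close> is not in \<open>V\<close>, the point \<open>y\<close>
      differs from \<open>x\<close> and can be separated from it: a neighbourhood of
      \<open>y\<close> yields the piece, one of \<open>x\<close> the next stage.\<close>
    obtain y where y: "y \<in> V" "y \<in> C" using assms(4) C unfolding in_closure_of by blast
    then have "y \<in> topspace X" "y \<noteq> x" using C openin_subset assms(5) by blast+
    then obtain P Q where PQ: "openin X P" "openin X Q" "x \<in> P" "y \<in> Q" "disjnt P Q"
      using assms(1) xX unfolding Hausdorff_space_def by metis
    have "openin X (P \<inter> C)" using PQ C by blast
    moreover have "(Q \<inter> C \<inter> V) \<inter> (P \<inter> C) = {}" using PQ(5) by (auto simp: disjnt_def)
    ultimately show ?thesis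
      using PQ y C assms(3) by (intro exI[of _ "P \<inter> C"] exI[of _ "Q \<inter> C \<inter> V"]) auto
  qed
  then obtain c q where cq: "\<And>C. openin X C \<Longrightarrow> x \<in> C \<Longrightarrow>
      openin X (c C) \<and> x \<in> c C \<and> c C \<subseteq> C \<and> openin X (q C) \<and> q C \<subseteq> C \<inter> V \<and> q C \<noteq> {} \<and> q C \<inter> c C = {}"
    by metis
  \<comment> \<open>Intersecting with \<open>B (Suc n)\<close> keeps \<open>C n\<close> inside
    \<open>B n\<close>, so the sets \<open>C n\<close> shrink to \<open>x\<close>.\<close>
  define C where "C = rec_nat (B 0) (\<lambda>n C. c C \<inter> B (Suc n))"
  have C0: "C 0 = B 0" and CS: "C (Suc n) = c (C n) \<inter> B (Suc n)" for n
    by (simp_all add: C_def)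
  have C: "openin X (C n) \<and> x \<in> C n" for n
    by (induction n) (use B cq in \<open>auto simp: C0 CS intro!: openin_Int\<close>)
  note cqC = cq[OF conjunct1[OF C] conjunct2[OF C]]
  have CB: "C n \<subseteq> B n" for n by (cases n) (auto simp: C0 CS)
  have "C (Suc n) \<subseteq> C n" for n using cqC[of n] by (auto simp: CS)
  then have dec: "C m \<subseteq> C n" if "n \<le> m" for m n
    using that by (rule lift_Suc_antimono_le)
  have disj: "q (C n) \<inter> q (C m) = {}" if "n < m" for m n
  proof -
    \<comment> \<open>A later piece lies in \<open>C (Suc n)\<close>, hence in
      \<open>c (C n)\<close>, which the piece \<open>q (C n)\<close> avoids.\<close>
    have "q (C m) \<subseteq> C (Suc n)" using dec[of "Suc n" m] that cqC[of m] by auto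
    then show ?thesis using cqC[of n] by (auto simp: CS)
  qed
  have disj': "q (C n) \<inter> q (C m) = {}" if "n \<noteq> m" for m n
    using disj[of n m] disj[of m n] that by (cases "n < m") auto
  \<comment> \<open>An unbounded set \<open>M\<close> of stages suffices, because every
    neighbourhood of \<open>x\<close> contains all pieces from some stage on.\<close>
  have cl: "x \<in> X closure_of (\<Union>n\<in>M. q (C n))" if M: "\<And>k. \<exists>n\<ge>k. n \<in> M" for M
    unfolding in_closure_of
  proof (intro conjI allI impI)
    fix T assume "x \<in> T \<and> openin X T"
    then obtain k where "B k \<subseteq> T" using base by blast
    moreover obtain n where n: "n \<ge> k" "n \<in> M" using M by blast
    ultimately have "q (C n) \<subseteq> T" using CB[of k] dec[OF n(1)] cqC[of n] by blast
    then show "\<exists>y. y \<in> (\<Union>n\<in>M. q (C n)) \<and> y \<in> T" using n cqC[of n] by blast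
  qed (fact xX)
  show thesis
  proof
    show "openin X (\<Union>n\<in>{n. even n}. q (C n))" "openin X (\<Union>n\<in>{n. odd n}. q (C n))"
      using cqC by blast+
    show "(\<Union>n\<in>{n. even n}. q (C n)) \<subseteq> V" "(\<Union>n\<in>{n. odd n}. q (C n)) \<subseteq> V"
      using cqC by blast+
    show "(\<Union>n\<in>{n. even n}. q (C n)) \<inter> (\<Union>n\<in>{n. odd n}. q (C n)) = {}"
    proof (rule equals0I, clarify)
      fix y m n assume "y \<in> q (C m)" "y \<in> q (C n)" "even m" "odd n"
      then show False using disj'[of m n] by (cases "m = n") auto
    qed
    show "x \<in> X closure_of (\<Union>n\<in>{n. even n}. q (C n))"
      by (rule cl) (metis dvd_triv_left mem_Collect_eq mult_2 le_add1)
    show "x \<in> X closure_of (\<Union>n\<in>{n. odd n}. q (C n))"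
      by (rule cl) (metis dvd_triv_left mem_Collect_eq mult_2 le_add1 even_Suc le_SucI)
  qed
qed

section \<open>Open sets in products are determined up to density by countably many
  coordinates\<close>

text \<open>
  The coordinate set \<open>S\<close> is closed off so that two basic boxes, one arbitrary in \<open>W\<close> and one among
  the countably many chosen, share constrained coordinates only where they are already compatible.
  This avoids the \<open>\<Delta>\<close>-system lemma.
\<close>
lemma ccc_open_countable_support:
  assumes ccc: "\<And>S. countable S \<Longrightarrow> S \<subseteq> I \<Longrightarrow> ccc_space (product_topology X S)"
    and W: "openin (product_topology X I) W"
  obtains S V where "countable S" "S \<subseteq> I" "openin (product_topology X S) V"
    "{f \<in> topspace (product_topology X I). restrict f S \<in> V} \<subseteq> W"
    "W \<subseteq> product_topology X I closure_of {f \<in> topspace (product_topology X I). restrict f S \<in> V}"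
proof -
  let ?P = "product_topology X I"
  define supp where "supp U = {i \<in> I. U i \<noteq> topspace (X i)}" for U
  \<comment> \<open>Boxes inside \<open>W\<close> are represented by their families of factors, so
    that the same \<open>U\<close> can be projected to any coordinate set \<open>S\<close> as
    \<open>PiE S U\<close>.\<close>
  define G where "G = {U. finite (supp U) \<and> (\<forall>i\<in>I. openin (X i) (U i)) \<and>
    PiE I U \<noteq> {} \<and> PiE I U \<subseteq> W}"
  have Gne: "U i \<noteq> {}" and Gop: "openin (X i) (U i)" if "U \<in> G" "i \<in> I" for U i
    using that by (auto simp: G_def PiE_eq_empty_iff)
  have oG: "openin (product_topology X S) (PiE S U)" if "U \<in> G" "S \<subseteq> I" for U S
  proof -
    have "finite {i \<in> S. U i \<noteq> topspace (X i)}"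
      by (rule finite_subset[of _ "supp U"]) (use that in \<open>auto simp: G_def supp_def\<close>)
    then show ?thesis using that Gop unfolding openin_PiE_gen by blast
  qed
  \<comment> \<open>By c.c.c. of the product over \<open>S\<close>, countably many projected boxes
    have a union whose closure contains every projected box. Each projected box is nonempty and
    open, so it meets one of them.\<close>
  have "\<exists>H. countable H \<and> H \<subseteq> G \<and> (\<forall>U\<in>G. \<exists>U'\<in>H. PiE S U \<inter> PiE S U' \<noteq> {})"
    if S: "countable S" "S \<subseteq> I" for S
  proof -
    obtain \<V> where \<V>: "countable \<V>" "\<V> \<subseteq> PiE S ` G"
        "\<Union>(PiE S ` G) \<subseteq> product_topology X S closure_of \<Union>\<V>"
      by (rule ccc_space_countable_subfamily[OF ccc[OF S], of "PiE S ` G"]) (use oG S in auto)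
    obtain H where H: "countable H" "H \<subseteq> G" "\<V> = PiE S ` H"
      using \<V> countable_subset_image by metis
    have "\<exists>U'\<in>H. PiE S U \<inter> PiE S U' \<noteq> {}" if U: "U \<in> G" for U
    proof -
      have "PiE S U \<noteq> {}" using Gne[OF U] S by (auto simp: PiE_eq_empty_iff)
      then obtain f where f: "f \<in> PiE S U" by blast
      then have "f \<in> product_topology X S closure_of \<Union>\<V>" using \<V>(3) U by blast
      then obtain g where "g \<in> \<Union>\<V>" "g \<in> PiE S U"
        using f oG[OF U S(2)] unfolding in_closure_of by blast
      then show ?thesis using H(3) by blast
    qed
    then show ?thesis using H by blast
  qed
  then obtain h where h: "\<And>S. countable S \<Longrightarrow> S \<subseteq> I \<Longrightarrow> countable (h S)"
      "\<And>S. countable S \<Longrightarrow> S \<subseteq> I \<Longrightarrow> h S \<subseteq> G"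
      "\<And>S U. countable S \<Longrightarrow> S \<subseteq> I \<Longrightarrow> U \<in> G \<Longrightarrow> \<exists>U'\<in>h S. PiE S U \<inter> PiE S U' \<noteq> {}"
    by metis
  \<comment> \<open>Each stage adds the finite supports of the boxes chosen for the previous one. In
    the limit \<open>S\<close> contains the support of every chosen box.\<close>
  define T where "T = rec_nat {} (\<lambda>n S. S \<union> (\<Union>U\<in>h S. supp U))"
  have T0: "T 0 = {}" and TS: "T (Suc n) = T n \<union> (\<Union>U\<in>h (T n). supp U)" for n
    by (simp_all add: T_def)
  have T: "countable (T n) \<and> T n \<subseteq> I" for n
  proof (induction n)
    case (Suc n)
    have "countable (supp U)" if "U \<in> h (T n)" for U
      using that h(2)[of "T n"] Suc by (auto simp: G_def intro!: countable_finite)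
    then show ?case using Suc h(1)[of "T n"] by (auto simp: TS supp_def)
  qed (simp add: T0)
  note hT = h[OF conjunct1[OF T] conjunct2[OF T]]
  have mono: "T m \<subseteq> T n" if "m \<le> n" for m n
    using that by (rule lift_Suc_mono_le[rotated]) (auto simp: TS)
  define S where "S = (\<Union>n. T n)"
  define H where "H = (\<Union>n. h (T n))"
  have SI: "S \<subseteq> I" using T by (auto simp: S_def)
  have HG: "H \<subseteq> G" using hT(2) by (auto simp: H_def)
  have suppH: "supp U \<subseteq> S" if "U \<in> H" for U
    using that TS unfolding S_def H_def by blast
  let ?V = "\<Union>U\<in>H. PiE S U"
  show thesis
  proof
    show "countable S" using T by (auto simp: S_def)
    show "S \<subseteq> I" by (fact SI)
    show "openin (product_topology X S) ?V"
      using oG HG SI by blast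
    show "{f \<in> topspace ?P. restrict f S \<in> ?V} \<subseteq> W"
    proof clarify
      fix f U assume f: "f \<in> topspace ?P" "U \<in> H" "restrict f S \<in> PiE S U"
      \<comment> \<open>Outside \<open>S\<close> the factors of a chosen box are full, so the
        restriction to \<open>S\<close> decides membership in the box.\<close>
      have "f i \<in> U i" if "i \<in> I" for i
      proof (cases "i \<in> S")
        case True
        then show ?thesis using f(3) by (auto simp: PiE_iff)
      next
        case False
        then have "U i = topspace (X i)" using suppH[OF f(2)] that by (auto simp: supp_def)
        then show ?thesis using f(1) that by (auto simp: PiE_iff)
      qed
      then have "f \<in> PiE I U" using f(1) by (auto simp: PiE_iff)
      then show "f \<in> W" using f(2) HG by (auto simp: G_def)
    qed
    show "W \<subseteq> ?P closure_of {f \<in> topspace ?P. restrict f S \<in> ?V}"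
    proof
      fix f assume f: "f \<in> W"
      have "\<exists>g. g \<in> {f \<in> topspace ?P. restrict f S \<in> ?V} \<and> g \<in> O'"
        if O': "f \<in> O'" "openin ?P O'" for O'
      proof -
        have "openin ?P (O' \<inter> W)" using O' W by blast
        then obtain U where U: "finite (supp U)" "\<forall>i\<in>I. openin (X i) (U i)"
            "f \<in> PiE I U" "PiE I U \<subseteq> O' \<inter> W"
          using f O'(1) unfolding openin_product_topology_alt supp_def by (meson IntI)
        then have UG: "U \<in> G" by (auto simp: G_def)
        \<comment> \<open>The support of \<open>U\<close> is finite and the stages increase, so one
          stage captures all of it that ever enters \<open>S\<close>. The box \<open>U'\<close> is
          taken from the choice made at that stage.\<close>
        have "\<exists>n. supp U \<inter> S \<subseteq> T n"
        proof -
          have "\<forall>i\<in>supp U \<inter> S. \<exists>n. i \<in> T n" by (auto simp: S_def)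
          then obtain m where m: "\<forall>i\<in>supp U \<inter> S. i \<in> T (m i)" by metis
          have "finite (m ` (supp U \<inter> S))" using U(1) by simp
          then obtain n where "\<forall>k\<in>m ` (supp U \<inter> S). k \<le> n"
            using finite_nat_set_iff_bounded_le by blast
          then show ?thesis using m mono by blast
        qed
        then obtain n where n: "supp U \<inter> S \<subseteq> T n" by blast
        obtain U' where U': "U' \<in> h (T n)" "PiE (T n) U \<inter> PiE (T n) U' \<noteq> {}"
          using hT(3)[OF UG] by blast
        have U'H: "U' \<in> H" using U'(1) by (auto simp: H_def)
        then have U'G: "U' \<in> G" using HG by blast
        \<comment> \<open>On \<open>T n\<close> this is the choice of \<open>U'\<close>. Off
          \<open>T n\<close>, a coordinate in \<open>supp U\<close> lies outside \<open>S\<close>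
          and hence outside \<open>supp U'\<close>, so at least one factor is the whole space. The
          two boxes therefore meet in the full product.\<close>
        have "U i \<inter> U' i \<noteq> {}" if "i \<in> I" for i
        proof (cases "i \<in> T n")
          case True
          then show ?thesis using U'(2) by (auto simp: PiE_iff)
        next
          case False
          then have "i \<notin> supp U \<or> i \<notin> supp U'" using n suppH[OF U'H] by blast
          then have "U i = topspace (X i) \<or> U' i = topspace (X i)" using that by (auto simp: supp_def)
          then show ?thesis
            using Gne[OF UG that] Gne[OF U'G that] openin_subset[OF Gop[OF UG that]]
              openin_subset[OF Gop[OF U'G that]] by blast
        qed
        then have "PiE I (\<lambda>i. U i \<inter> U' i) \<noteq> {}" by (simp add: PiE_eq_empty_iff)
        then obtain g where g: "g \<in> PiE I (\<lambda>i. U i \<inter> U' i)" by blast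
        then have "g \<in> PiE I U" by (auto simp: PiE_iff)
        then have "g \<in> O'" "g \<in> topspace ?P" using U(4) openin_subset[OF O'(2)] by blast+
        moreover have "restrict g S \<in> PiE S U'" using g SI by (auto simp: PiE_iff)
        ultimately show ?thesis using U'H by blast
      qed
      moreover have "f \<in> topspace ?P" using f openin_subset[OF W] by blast
      ultimately show "f \<in> ?P closure_of {f \<in> topspace ?P. restrict f S \<in> ?V}"
        unfolding in_closure_of by blast
    qed
  qed
qed

section \<open>Disjoint tightness of dense submaximal subspaces of powers\<close>

theorem theorem5p9:
  fixes L :: "'a topology" and \<kappa> :: "'i set" and X :: "('i \<Rightarrow> 'a) set"
  assumes "Hausdorff_space L"
    and "first_countable L"
    and "ccc_space (power_topology L (UNIV :: nat set))"
    and "dense_subset_of (power_topology L \<kappa>) X"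
    and "submaximal_space (subtopology (power_topology L \<kappa>) X)"
  shows "disjoint_tightness (subtopology (power_topology L \<kappa>) X)"
  unfolding disjoint_tightness_def
proof (intro allI impI, elim conjE)
  let ?P = "power_topology L \<kappa>"
  let ?X = "subtopology ?P X"
  fix A x assume A: "A \<subseteq> topspace ?X" and xA: "x \<in> ?X derived_set_of A"
  have dense: "?P closure_of X = topspace ?P"
    using assms(4) by (auto simp: dense_subset_of_def)
  have x: "x \<in> topspace ?P" "x \<in> X" using xA by (auto simp: in_derived_set_of)
  \<comment> \<open>A second point excludes the degenerate case: if \<open>L\<close> were empty, the
    existence of \<open>x\<close> would force \<kappa> to be empty and the power to be a single
    point.\<close>
  obtain a where a: "a \<in> A" "a \<noteq> x"
    using xA unfolding in_derived_set_of by blast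
  then have "a \<in> topspace ?P" using A by auto
  then have neL: "topspace L \<noteq> {}" using x(1) a(2) by (force simp: PiE_iff intro: extensionalityI)
  define I where "I = ?X interior_of (A - {x})"
  have IA: "I \<subseteq> A - {x}" unfolding I_def by (rule interior_of_subset)
  have xI: "x \<in> ?X closure_of I"
    unfolding I_def by (rule submaximal_derived_set_imp_closure_of_interior[OF assms(5) A xA])
  have "openin ?X I" by (simp add: I_def)
  then obtain W where W: "openin ?P W" "I = W \<inter> X" by (auto simp: openin_subtopology)
  have xW: "x \<notin> W" using IA W(2) x(2) by blast
  have "ccc_space (power_topology L S)" if "countable S" for S :: "'i set"
    using ccc_space_countable_power[OF assms(3) that neL] .
  then obtain S V where S: "countable S" "S \<subseteq> \<kappa>" and V: "openin (power_topology L S) V"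
    and VW: "{f \<in> topspace ?P. restrict f S \<in> V} \<subseteq> W"
    and WV: "W \<subseteq> ?P closure_of {f \<in> topspace ?P. restrict f S \<in> V}"
    by (rule ccc_open_countable_support[OF _ W(1)])
  let ?r = "\<lambda>f. restrict f S"
  \<comment> \<open>Closeness to \<open>x\<close> is passed from \<open>I\<close> to
    \<open>W\<close>, then to the preimage of \<open>V\<close>, which is dense in \<open>W\<close>,
    and finally by continuity of restriction to \<open>V\<close> itself.\<close>
  have "x \<in> ?P closure_of W"
    using xI W(2) closure_of_mono[of "X \<inter> I" W ?P] by (auto simp: closure_of_subtopology)
  moreover have "?P closure_of W \<subseteq> ?P closure_of {f \<in> topspace ?P. ?r f \<in> V}"
    using WV by (intro closure_of_minimal) auto
  ultimately have "x \<in> ?P closure_of {f \<in> topspace ?P. ?r f \<in> V}" by blast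
  then have "?r x \<in> power_topology L S closure_of (?r ` {f \<in> topspace ?P. ?r f \<in> V})"
    using continuous_map_image_closure_subset[OF continuous_on_restrict[OF S(2)]] by blast
  then have rx: "?r x \<in> power_topology L S closure_of V"
    using closure_of_mono[of "?r ` {f \<in> topspace ?P. ?r f \<in> V}" V] by blast
  \<comment> \<open>Otherwise \<open>x\<close> would lie in the preimage of \<open>V\<close>, hence
    in \<open>W\<close>. The splitting lemma requires a point outside \<open>V\<close>.\<close>
  have rxV: "?r x \<notin> V" using VW xW x(1) by blast
  have "Hausdorff_space (power_topology L S)"
    using assms(1) by (simp add: Hausdorff_space_product_topology)
  moreover have "first_countable (power_topology L S)"
    using S(1) assms(2) by (rule first_countable_countable_product)
  ultimately obtain V1 V2 where V12: "openin (power_topology L S) V1" "openin (power_topology L S) V2"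
    "V1 \<subseteq> V" "V2 \<subseteq> V" "V1 \<inter> V2 = {}"
    "?r x \<in> power_topology L S closure_of V1" "?r x \<in> power_topology L S closure_of V2"
    by (rule Hausdorff_first_countable_split_open[OF _ _ V rx rxV])
  define A' where "A' U = {f \<in> topspace ?P. ?r f \<in> U} \<inter> X" for U
  have A'A: "A' U \<subseteq> A - {x}" if "U \<subseteq> V" for U
    using that VW W(2) IA by (auto simp: A'_def)
  have "x \<in> ?X derived_set_of A' U"
    if U: "openin (power_topology L S) U" "U \<subseteq> V" "?r x \<in> power_topology L S closure_of U" for U
  proof -
    let ?U = "{f \<in> topspace ?P. ?r f \<in> U}"
    have "openin ?P ?U"
      by (rule openin_continuous_map_preimage[OF continuous_on_restrict[OF S(2)] U(1)])
    \<comment> \<open>Intersecting the open set \<open>?U\<close> with the dense set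
      \<open>X\<close> does not change its closure, and openness of restriction places
      \<open>x\<close> in that closure.\<close>
    then have "?P closure_of A' U = ?P closure_of ?U"
      unfolding A'_def using dense openin_subset by (intro closure_of_openin_Int_superset) auto
    moreover have "x \<in> ?P closure_of ?U"
      using open_map_preimage_closure_of[of _ _ "\<lambda>f. restrict f S",
          OF open_map_restrict_product_topology[OF S(2)] x(1) U(3)] .
    ultimately have "x \<in> ?X closure_of A' U"
      using x(2) by (simp add: closure_of_subtopology A'_def Int_absorb1)
    \<comment> \<open>As \<open>A' U\<close> misses \<open>x\<close>, being in its closure already
      means being an accumulation point.\<close>
    then show ?thesis
      using A'A[OF U(2)] unfolding in_derived_set_of in_closure_of by blast
  qed
  then have "x \<in> ?X derived_set_of A' V1 \<inter> ?X derived_set_of A' V2"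
    using V12 by blast
  moreover have "A' V1 \<subseteq> A" "A' V2 \<subseteq> A" "A' V1 \<inter> A' V2 = {}"
    using A'A V12 by (auto simp: A'_def)
  ultimately show "\<exists>A1 A2. A1 \<subseteq> A \<and> A2 \<subseteq> A \<and> A1 \<inter> A2 = {} \<and>
      x \<in> ?X derived_set_of A1 \<inter> ?X derived_set_of A2" by blast
qed

end
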